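(* Let $G$ be a finite group, let $F_G$ be the free group on the set $G$, and write $G=F_G/H$, where $H$ is the kernel of the canonical map $F_G\to G$. Let $K=\mathcal{G}(\partial\mathcal{C}_p(G))$ be the group generated by the dual of the palindrome Cayley machine of $G$. Then $K\simeq G^{(p)}=F_G/(H\cap H^{R})$. Moreover, under this identification, $\mathrm{Stab}_K(u)=H/(H\cap H^{R})$ for every word $u\in G$ of length one, and $\mathrm{Stab}_K(u)=\{1\}$ for every word $u\in G^{*}$ of length at least $2$.
   Context: A transducer has a finite state set $Q$, a finite alphabet $A$, and for each state $q$ and letter $a$ exactly one edge $q\xrightarrow{a|b}p$ (input $a$, output $b$, next state $p$). Each state $q$ acts on $A^*$: on $a_1\ldots a_n$ it outputs $b$ where $q\xrightarrow{a_1|b}p$, and then $p$ acts on $a_2\ldots a_n$. The transducer is invertible if each state induces a permutation $a\mapsto b$ of $A$; then the states generate a group $\mathcal{G}$ of automorphisms of $A^*$, a quotient of the free group $F_Q$. Convention: a product $q_1q_2\cdots q_n$ acts by applying $q_1$ first, then $q_2$, and so on. The dual $\partial\mathcal{A}$ has states $A$, alphabet $Q$, and an edge $a\xrightarrow{p|q}b$ for each edge $p\xrightarrow{a|b}q$ of $\mathcal{A}$. The palindrome Cayley machine $\mathcal{C}_p(G)$ has states $G$, alphabet $G$ and edges $g\xrightarrow{x|x^{-1}}gx$ for $g,x\in G$. Thus $\partial\mathcal{C}_p(G)$ has edges $x\xrightarrow{g|gx}x^{-1}$, so the generator $x\in G$ acts on words over the alphabet $G$ by $g_1g_2g_3g_4\ldots\mapsto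 (g_1x)(g_2x^{-1})(g_3x)(g_4x^{-1})\ldots$. For a word $u=u_1\ldots u_n$ over $\tilde G=G\sqcup G^{-1}$ ($G^{-1}$ formal inverses), its mirror is $u^R=u_n\ldots u_1$. For a subgroup $H\le F_G$, $H^R\le F_G$ is the subgroup of elements whose reduced words are the mirrors of the reduced words of elements of $H$. The identification $K\simeq F_G/(H\cap H^R)$ is the one induced by sending each free generator $x\in G$ of $F_G$ to the corresponding generator (state) $x$ of $K$. $\mathrm{Stab}_K(u)$ is the stabilizer in $K$ of the word $u$. *)

theory Defs
  imports "HOL-Algebra.Generated_Groups" "HOL-Algebra.Group_Action"
begin

section \<open>Free groups\<close>

text \<open>Words over the disjoint union of \<open>X\<close> and a set of formal inverses: \<open>Inl x\<close> is the letter
  \<open>x\<close>, and \<open>Inr x\<close> its formal inverse. The free group consists of the reduced words.\<close>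

type_synonym 'a letter = "'a + 'a"

fun inv_letter :: "'a letter \<Rightarrow> 'a letter" where
  "inv_letter (Inl x) = Inr x"
| "inv_letter (Inr x) = Inl x"

definition reduced :: "'a letter list \<Rightarrow> bool" where
  "reduced w \<longleftrightarrow> successively (\<lambda>a b. b \<noteq> inv_letter a) w"

fun push :: "'a letter \<Rightarrow> 'a letter list \<Rightarrow> 'a letter list" where
  "push a [] = [a]"
| "push a (b # w) = (if b = inv_letter a then w else a # b # w)"

text \<open>If \<open>v\<close> is reduced, then \<open>foldr push u v\<close> is the reduced form of the concatenation
  \<open>u @ v\<close>.\<close>

definition free_group :: "'a set \<Rightarrow> 'a letter list monoid" where
  "free_group X =
    \<lparr>carrier = {w \<in> lists (X <+> X). reduced w}, mult = foldr push, one = []\<rparr>"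

definition free_gen :: "'a \<Rightarrow> 'a letter list" where
  "free_gen x = [Inl x]"

fun letter_value :: "('b, 'm) monoid_scheme \<Rightarrow> ('a \<Rightarrow> 'b) \<Rightarrow> 'a letter \<Rightarrow> 'b" where
  "letter_value M f (Inl x) = f x"
| "letter_value M f (Inr x) = inv\<^bsub>M\<^esub> (f x)"

text \<open>The homomorphism from the free group to \<open>M\<close> that extends \<open>f\<close>.\<close>

definition free_lift :: "('b, 'm) monoid_scheme \<Rightarrow> ('a \<Rightarrow> 'b) \<Rightarrow> 'a letter list \<Rightarrow> 'b" where
  "free_lift M f w = foldr (\<lambda>a y. letter_value M f a \<otimes>\<^bsub>M\<^esub> y) w \<one>\<^bsub>M\<^esub>"

lemma inv_letter_inv [simp]: "inv_letter (inv_letter a) = a"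
  by (cases a) auto

lemma inv_letter_in [simp]: "inv_letter a \<in> X <+> X \<longleftrightarrow> a \<in> X <+> X"
  by (cases a) auto

lemma inv_letter_neq [simp]: "inv_letter a \<noteq> a" "a \<noteq> inv_letter a"
  by (cases a; simp)+

lemma reduced_Nil [simp]: "reduced []"
  by (simp add: reduced_def)

lemma reduced_push: "reduced w \<Longrightarrow> reduced (push a w)"
  by (cases w) (auto simp: reduced_def successively_Cons)

lemma push_push_inv: "reduced w \<Longrightarrow> push a (push (inv_letter a) w) = w"
proof (cases w)
  case (Cons b v)
  assume "reduced w"
  with Cons show ?thesis
    by (cases v) (auto simp: reduced_def successively_Cons)
qed simp

lemma reduced_foldr_push: "reduced w \<Longrightarrow> reduced (foldr push u w)"
  by (induction u) (auto intro: reduced_push)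

lemma push_in_lists: "a \<in> X <+> X \<Longrightarrow> w \<in> lists (X <+> X) \<Longrightarrow> push a w \<in> lists (X <+> X)"
  by (cases w) auto

lemma foldr_push_in_lists:
  "u \<in> lists (X <+> X) \<Longrightarrow> w \<in> lists (X <+> X) \<Longrightarrow> foldr push u w \<in> lists (X <+> X)"
  by (induction u) (auto simp: push_in_lists simp del: in_lists_conv_set)

lemma foldr_push_push:
  assumes "reduced w"
  shows "foldr push (push a v) w = push a (foldr push v w)"
proof (cases v)
  case (Cons b v')
  show ?thesis
  proof (cases "b = inv_letter a")
    case True
    then show ?thesis
      using Cons push_push_inv[OF reduced_foldr_push[OF assms], of a v'] by simp
  qed (use Cons in simp)
qed simp

lemma foldr_push_assoc:
  "reduced w \<Longrightarrow> foldr push (foldr push u v) w = foldr push u (foldr push v w)"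
  by (induction u) (auto simp: foldr_push_push)

lemma foldr_push_Nil: "reduced w \<Longrightarrow> foldr push w [] = w"
proof (induction w)
  case (Cons a w)
  then show ?case
    by (cases w) (auto simp: reduced_def successively_Cons)
qed simp

lemma foldr_push_left_inverse:
  "reduced w \<Longrightarrow> foldr push (rev (map inv_letter u)) (foldr push u w) = w"
proof (induction u)
  case (Cons a u)
  then show ?case
    using push_push_inv[OF reduced_foldr_push[OF Cons.prems], of "inv_letter a" u] by simp
qed simp

lemma group_free_group: "group (free_group X)"
proof (rule groupI)
  fix u assume u: "u \<in> carrier (free_group X)"
  define v where "v = foldr push (rev (map inv_letter u)) []"
  have "rev (map inv_letter u) \<in> lists (X <+> X)"
    using u by (auto simp: free_group_def)
  then have "v \<in> carrier (free_group X)"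
    unfolding v_def free_group_def
    by (simp add: reduced_foldr_push foldr_push_in_lists del: in_lists_conv_set)
  moreover have "v \<otimes>\<^bsub>free_group X\<^esub> u = \<one>\<^bsub>free_group X\<^esub>"
  proof -
    have "foldr push v u = foldr push (rev (map inv_letter u)) (foldr push [] u)"
      using u unfolding v_def by (intro foldr_push_assoc) (auto simp: free_group_def)
    also have "\<dots> = foldr push (rev (map inv_letter u)) (foldr push u [])"
      using u by (simp add: free_group_def foldr_push_Nil)
    also have "\<dots> = []"
      by (rule foldr_push_left_inverse) simp
    finally show ?thesis by (simp add: free_group_def)
  qed
  ultimately show "\<exists>v\<in>carrier (free_group X). v \<otimes>\<^bsub>free_group X\<^esub> u = \<one>\<^bsub>free_group X\<^esub>"
    by blast
qed (auto simp: free_group_def foldr_push_assoc reduced_foldr_push foldr_push_in_lists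
          simp del: in_lists_conv_set)

lemma free_gen_in [simp]: "x \<in> X \<Longrightarrow> free_gen x \<in> carrier (free_group X)"
  by (auto simp: free_group_def free_gen_def reduced_def)

context group
begin

lemma letter_value_closed [simp]:
  "f \<in> X \<rightarrow> carrier G \<Longrightarrow> a \<in> X <+> X \<Longrightarrow> letter_value G f a \<in> carrier G"
  by (cases a) auto

lemma free_lift_closed [simp]:
  "f \<in> X \<rightarrow> carrier G \<Longrightarrow> w \<in> lists (X <+> X) \<Longrightarrow> free_lift G f w \<in> carrier G"
  by (induction w) (auto simp: free_lift_def simp del: in_lists_conv_set)

lemma letter_value_inv_letter:
  "f \<in> X \<rightarrow> carrier G \<Longrightarrow> a \<in> X <+> X \<Longrightarrow>
    letter_value G f (inv_letter a) = inv (letter_value G f a)"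
  by (cases a) (auto simp: Pi_iff)

lemma free_lift_Cons: "free_lift G f (a # w) = letter_value G f a \<otimes> free_lift G f w"
  by (simp add: free_lift_def)

lemma free_lift_append:
  assumes "f \<in> X \<rightarrow> carrier G" "u \<in> lists (X <+> X)" "v \<in> lists (X <+> X)"
  shows "free_lift G f (u @ v) = free_lift G f u \<otimes> free_lift G f v"
  using assms(2)
proof (induction u)
  case Nil
  then show ?case
    using free_lift_closed[OF assms(1,3)] by (simp add: free_lift_def)
next
  case (Cons a u)
  then show ?case
    using letter_value_closed[OF assms(1), of a] free_lift_closed[OF assms(1), of u]
      free_lift_closed[OF assms(1,3)]
    by (simp add: free_lift_Cons m_assoc del: in_lists_conv_set)
qed

lemma free_lift_push:
  assumes f: "f \<in> X \<rightarrow> carrier G" and a: "a \<in> X <+> X" and w: "w \<in> lists (X <+> X)"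
  shows "free_lift G f (push a w) = letter_value G f a \<otimes> free_lift G f w"
proof (cases w)
  case (Cons b v)
  have v: "free_lift G f v \<in> carrier G" and la: "letter_value G f a \<in> carrier G"
    using w Cons free_lift_closed[OF f, of v] letter_value_closed[OF f a] by auto
  show ?thesis
  proof (cases "b = inv_letter a")
    case True
    then have "letter_value G f b = inv (letter_value G f a)"
      using letter_value_inv_letter[OF f a] by simp
    then show ?thesis
      using Cons True v la by (simp add: free_lift_Cons m_assoc[symmetric])
  next
    case False
    then show ?thesis
      using Cons by (simp add: free_lift_Cons)
  qed
qed (simp add: free_lift_Cons)

lemma free_lift_hom:
  assumes f: "f \<in> X \<rightarrow> carrier G"
  shows "free_lift G f \<in> hom (free_group X) G"
proof (rule homI)
  fix u v assume "u \<in> carrier (free_group X)" "v \<in> carrier (free_group X)"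
  then have u: "u \<in> lists (X <+> X)" and v: "v \<in> lists (X <+> X)"
    by (simp_all add: free_group_def)
  have "free_lift G f (foldr push u v) = free_lift G f u \<otimes> free_lift G f v"
    using u
  proof (induction u)
    case Nil
    then show ?case
      using free_lift_closed[OF f v] by (simp add: free_lift_def)
  next
    case (Cons a u)
    then have "a \<in> X <+> X" "u \<in> lists (X <+> X)" by auto
    then show ?case
      using Cons letter_value_closed[OF f, of a] free_lift_closed[OF f, of u]
        free_lift_closed[OF f v]
      by (simp add: free_lift_push[OF f] foldr_push_in_lists[OF _ v] free_lift_Cons m_assoc
               del: in_lists_conv_set)
  qed
  then show "free_lift G f (u \<otimes>\<^bsub>free_group X\<^esub> v) = free_lift G f u \<otimes> free_lift G f v"
    by (simp add: free_group_def)
qed (simp add: free_group_def free_lift_closed[OF f] del: in_lists_conv_set)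

lemma free_lift_gen: "f \<in> X \<rightarrow> carrier G \<Longrightarrow> x \<in> X \<Longrightarrow> free_lift G f (free_gen x) = f x"
  by (auto simp: free_gen_def free_lift_def Pi_iff)

end

section \<open>Kernel of the canonical map and mirrors\<close>

definition canonical_kernel :: "('a, 'm) monoid_scheme \<Rightarrow> 'a letter list set" where
  "canonical_kernel G = kernel (free_group (carrier G)) G (free_lift G (\<lambda>x. x))"

definition mirror :: "'a letter list set \<Rightarrow> 'a letter list set" where
  "mirror H = rev ` H"

lemma reduced_rev [simp]: "reduced (rev w) \<longleftrightarrow> reduced w"
  unfolding reduced_def successively_rev
  by (rule arg_cong[where f = "\<lambda>P. successively P w"]) (metis inv_letter_inv)

context group
begin

lemma free_lift_rev:
  assumes "w \<in> lists (carrier G <+> carrier G)"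
  shows "free_lift G (\<lambda>x. x) (rev w) = inv (free_lift G (\<lambda>x. inv x) w)"
  using assms
proof (induction w rule: list.induct)
  case (Cons a w)
  have id: "(\<lambda>x. x) \<in> carrier G \<rightarrow> carrier G" and i: "(\<lambda>x. inv x) \<in> carrier G \<rightarrow> carrier G"
    by auto
  have a: "a \<in> carrier G <+> carrier G" and w: "w \<in> lists (carrier G <+> carrier G)"
    using Cons.prems by auto
  have rw: "rev w \<in> lists (carrier G <+> carrier G)"
    using w by auto
  have v: "letter_value G (\<lambda>x. x) a = inv (letter_value G (\<lambda>x. inv x) a)"
    using a by (cases a) auto
  have "free_lift G (\<lambda>x. x) (rev (a # w)) =
      free_lift G (\<lambda>x. x) (rev w) \<otimes> free_lift G (\<lambda>x. x) [a]"
    using free_lift_append[OF id rw] a by simp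
  also have "free_lift G (\<lambda>x. x) [a] = inv (letter_value G (\<lambda>x. inv x) a)"
    using v letter_value_closed[OF id a] by (simp add: free_lift_def)
  finally show ?case
    using Cons.IH[OF w] letter_value_closed[OF i a] free_lift_closed[OF i w]
    by (simp add: free_lift_Cons inv_mult_group)
qed (simp add: free_lift_def)

lemma mirror_canonical_kernel:
  "mirror (canonical_kernel G) = kernel (free_group (carrier G)) G (free_lift G (\<lambda>x. inv x))"
proof -
  have i: "(\<lambda>x. inv x) \<in> carrier G \<rightarrow> carrier G" by auto
  have "w \<in> mirror (canonical_kernel G) \<longleftrightarrow> rev w \<in> canonical_kernel G" for w
    unfolding mirror_def by (metis image_iff rev_rev_ident)
  moreover have "rev w \<in> canonical_kernel G \<longleftrightarrow>
      w \<in> kernel (free_group (carrier G)) G (free_lift G (\<lambda>x. inv x))" for w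
  proof (cases "w \<in> lists (carrier G <+> carrier G)")
    case True
    then show ?thesis
      using True free_lift_rev[OF True] free_lift_closed[OF i True] inv_eq_1_iff
      by (auto simp: canonical_kernel_def kernel_def free_group_def)
  qed (auto simp: canonical_kernel_def kernel_def free_group_def)
  ultimately show ?thesis by blast
qed

lemma canonical_kernel_Int_mirror_normal:
  "canonical_kernel G \<inter> mirror (canonical_kernel G) \<lhd> free_group (carrier G)"
proof -
  interpret F: group "free_group (carrier G)" by (rule group_free_group)
  have "group_hom (free_group (carrier G)) G (free_lift G f)"
    if "f \<in> carrier G \<rightarrow> carrier G" for f
    using free_lift_hom[OF that] by unfold_locales
  then have "canonical_kernel G \<lhd> free_group (carrier G)"
    "mirror (canonical_kernel G) \<lhd> free_group (carrier G)"
    unfolding mirror_canonical_kernel unfolding canonical_kernel_def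
    by (auto intro!: group_hom.normal_kernel)
  then show ?thesis by (rule F.normal_subgroup_intersect)
qed

end

section \<open>Transducers\<close>

text \<open>There is an edge from \<open>q\<close> to \<open>next_state T q a\<close> with input \<open>a\<close> and output \<open>letter_out T q a\<close>,
  for every state \<open>q\<close> and every letter \<open>a\<close>. Values outside of these sets are irrelevant.\<close>

record ('q, 'a) transducer =
  states :: "'q set"
  alphabet :: "'a set"
  letter_out :: "'q \<Rightarrow> 'a \<Rightarrow> 'a"
  next_state :: "'q \<Rightarrow> 'a \<Rightarrow> 'q"

definition is_transducer :: "('q, 'a) transducer \<Rightarrow> bool" where
  "is_transducer T \<longleftrightarrow> finite (states T) \<and> finite (alphabet T) \<and>
    (\<forall>q\<in>states T. \<forall>a\<in>alphabet T. letter_out T q a \<in> alphabet T \<and> next_state T q a \<in> states T)"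

definition invertible_transducer :: "('q, 'a) transducer \<Rightarrow> bool" where
  "invertible_transducer T \<longleftrightarrow> is_transducer T \<and>
    (\<forall>q\<in>states T. bij_betw (letter_out T q) (alphabet T) (alphabet T))"

fun run :: "('q, 'a) transducer \<Rightarrow> 'q \<Rightarrow> 'a list \<Rightarrow> 'a list" where
  "run T q [] = []"
| "run T q (a # w) = letter_out T q a # run T (next_state T q a) w"

text \<open>Restricted to words over the alphabet, so as to obtain elements of \<^const>\<open>BijGroup\<close>.\<close>

definition state_action :: "('q, 'a) transducer \<Rightarrow> 'q \<Rightarrow> 'a list \<Rightarrow> 'a list" where
  "state_action T q = restrict (run T q) (lists (alphabet T))"

text \<open>In \<^const>\<open>BijGroup\<close> the right factor of a product is applied first. Here it is the left
  factor, hence the opposite multiplication.\<close>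

definition transducer_group :: "('q, 'a) transducer \<Rightarrow> ('a list \<Rightarrow> 'a list) monoid" where
  "transducer_group T = (let B = BijGroup (lists (alphabet T)) in
    \<lparr>carrier = generate B (state_action T ` states T),
     mult = \<lambda>f g. g \<otimes>\<^bsub>B\<^esub> f,
     one = \<one>\<^bsub>B\<^esub>\<rparr>)"

definition dual :: "('q, 'a) transducer \<Rightarrow> ('a, 'q) transducer" where
  "dual T = \<lparr>states = alphabet T, alphabet = states T,
    letter_out = \<lambda>a p. next_state T p a, next_state = \<lambda>a p. letter_out T p a\<rparr>"

definition palindrome_cayley_machine :: "('a, 'm) monoid_scheme \<Rightarrow> ('a, 'a) transducer" where
  "palindrome_cayley_machine G = \<lparr>states = carrier G, alphabet = carrier G,
    letter_out = \<lambda>g x. inv\<^bsub>G\<^esub> x, next_state = \<lambda>g x. g \<otimes>\<^bsub>G\<^esub> x\<rparr>"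

lemma (in group) is_transducer_palindrome_cayley_machine:
  "finite (carrier G) \<Longrightarrow> is_transducer (palindrome_cayley_machine G)"
  by (simp add: is_transducer_def palindrome_cayley_machine_def)

lemma (in group) invertible_transducer_dual_palindrome_cayley_machine:
  assumes "finite (carrier G)"
  shows "invertible_transducer (dual (palindrome_cayley_machine G))"
proof -
  have "bij_betw (\<lambda>g. g \<otimes> x) (carrier G) (carrier G)" if "x \<in> carrier G" for x
    by (rule bij_betwI[where g = "\<lambda>g. g \<otimes> inv x"]) (use that in \<open>auto simp: m_assoc\<close>)
  then show ?thesis
    using assms
    by (simp add: invertible_transducer_def is_transducer_def dual_def palindrome_cayley_machine_def)
qed

end

theory Submission
  imports Defs
begin

text \<open>Let \<open>a\<close> and \<open>b\<close> be the homomorphisms from \<open>F\<close> to \<open>G\<close> that send a generator \<open>x\<close> to \<open>x\<close> and to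
  \<open>x\<inverse>\<close> respectively. Since \<open>b w\<close> is the inverse of the value of \<open>a\<close> at the
  mirror of \<open>w\<close>, their kernels are \<open>H\<close> and \<open>H\<^sup>R\<close>. A generator \<open>x\<close> of \<open>K\<close> right-multiplies the
  letters of a word alternately by \<open>x\<close> and \<open>x\<inverse>\<close>; since left factors of a product act first, an
  arbitrary \<open>w \<in> F\<close> right-multiplies the letters alternately by \<open>a w\<close> and \<open>b w\<close>
  (\<open>free_lift_transducer_group\<close>). A group acts freely on itself by right multiplication, so the
  effect on the first letter determines \<open>a w\<close>, and the effect on the first two letters
  determines the entire transformation. Hence \<open>w\<close> acts trivially if and only if
  \<open>w \<in> H \<inter> H\<^sup>R\<close>, it fixes a given one-letter word if and only if \<open>w \<in> H\<close>, and it fixes a given longer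
  word only if it acts trivially. The first isomorphism theorem does the rest.\<close>

section \<open>Alternating translations\<close>

fun alt_mult :: "('a, 'm) monoid_scheme \<Rightarrow> 'a \<Rightarrow> 'a \<Rightarrow> 'a list \<Rightarrow> 'a list" where
  "alt_mult G p q [] = []"
| "alt_mult G p q (g # w) = (g \<otimes>\<^bsub>G\<^esub> p) # alt_mult G q p w"

text \<open>The restriction makes these transformations elements of \<^const>\<open>BijGroup\<close>.\<close>

definition alt_translation :: "('a, 'm) monoid_scheme \<Rightarrow> 'a \<Rightarrow> 'a \<Rightarrow> 'a list \<Rightarrow> 'a list" where
  "alt_translation G p q = restrict (alt_mult G p q) (lists (carrier G))"

context group
begin

lemma alt_mult_closed:
  "\<lbrakk>p \<in> carrier G; q \<in> carrier G; w \<in> lists (carrier G)\<rbrakk> \<Longrightarrow> alt_mult G p q w \<in> lists (carrier G)"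
  by (induction w arbitrary: p q) auto

lemma alt_mult_alt_mult:
  "\<lbrakk>p \<in> carrier G; q \<in> carrier G; p' \<in> carrier G; q' \<in> carrier G; w \<in> lists (carrier G)\<rbrakk> \<Longrightarrow>
    alt_mult G p' q' (alt_mult G p q w) = alt_mult G (p \<otimes> p') (q \<otimes> q') w"
  by (induction w arbitrary: p q p' q') (auto simp: m_assoc)

lemma alt_mult_one: "w \<in> lists (carrier G) \<Longrightarrow> alt_mult G \<one> \<one> w = w"
  by (induction w) auto

lemma alt_translation_in_BijGroup:
  assumes "p \<in> carrier G" "q \<in> carrier G"
  shows "alt_translation G p q \<in> carrier (BijGroup (lists (carrier G)))"
proof -
  have "bij_betw (alt_mult G p q) (lists (carrier G)) (lists (carrier G))"
    by (rule bij_betwI[where g = "alt_mult G (inv p) (inv q)"])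
       (use assms in \<open>auto simp: alt_mult_closed alt_mult_alt_mult alt_mult_one
                           simp del: in_lists_conv_set\<close>)
  then show ?thesis
    by (simp add: BijGroup_def Bij_def alt_translation_def)
qed

text \<open>The first factor in \<^const>\<open>BijGroup\<close> acts last, hence the exchanged order on the right.\<close>

lemma alt_translation_mult:
  assumes "p \<in> carrier G" "q \<in> carrier G" "p' \<in> carrier G" "q' \<in> carrier G"
  shows "alt_translation G p' q' \<otimes>\<^bsub>BijGroup (lists (carrier G))\<^esub> alt_translation G p q =
    alt_translation G (p \<otimes> p') (q \<otimes> q')"
proof -
  have "compose (lists (carrier G)) (alt_translation G p' q') (alt_translation G p q) =
      alt_translation G (p \<otimes> p') (q \<otimes> q')"
    using assms
    by (intro ext) (simp add: compose_def alt_translation_def alt_mult_closed alt_mult_alt_mult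
                         del: in_lists_conv_set)
  then show ?thesis
    using assms alt_translation_in_BijGroup
    by (simp add: BijGroup_def)
qed

lemma alt_translation_one: "alt_translation G \<one> \<one> = \<one>\<^bsub>BijGroup (lists (carrier G))\<^esub>"
  by (auto simp: BijGroup_def alt_translation_def alt_mult_one fun_eq_iff simp del: in_lists_conv_set)

lemma inv_alt_translation:
  assumes "p \<in> carrier G" "q \<in> carrier G"
  shows "inv\<^bsub>BijGroup (lists (carrier G))\<^esub> alt_translation G p q = alt_translation G (inv p) (inv q)"
  by (rule group.inv_equality[OF group_BijGroup])
     (use assms in \<open>simp_all add: alt_translation_mult alt_translation_one
                                 alt_translation_in_BijGroup\<close>)

lemma alt_translation_fixes_singleton_iff:
  assumes "p \<in> carrier G" "g \<in> carrier G"
  shows "alt_translation G p q [g] = [g] \<longleftrightarrow> p = \<one>"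
  using assms by (simp add: alt_translation_def)

text \<open>Right multiplication is free, so the first letter determines \<open>p\<close> and the second one \<open>q\<close>.\<close>

lemma alt_translation_fixes_iff:
  assumes "p \<in> carrier G" "q \<in> carrier G" "u \<in> lists (carrier G)" "length u \<ge> 2"
  shows "alt_translation G p q u = u \<longleftrightarrow> p = \<one> \<and> q = \<one>"
proof -
  obtain g h v where u: "u = g # h # v"
    using assms(4) by (cases u rule: list.exhaust[case_product list.exhaust])
      (metis One_nat_def Suc_le_length_iff numeral_2_eq_2)+
  then show ?thesis
    using assms alt_mult_one[of v] by (auto simp: alt_translation_def)
qed

end

section \<open>Transducer groups as images of free groups\<close>

text \<open>The opposite of a group is a group with the same inverses. Both facts are needed to map the
  free group to the transducer group.\<close>

lemma group_transducer_group:
  assumes "state_action T ` states T \<subseteq> carrier (BijGroup (lists (alphabet T)))"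
  shows "group (transducer_group T)"
proof -
  let ?B = "BijGroup (lists (alphabet T))"
  interpret B: group ?B by (rule group_BijGroup)
  interpret S: group "?B\<lparr>carrier := generate ?B (state_action T ` states T)\<rparr>"
    using B.generate_is_subgroup[OF assms] B.subgroup_imp_group by blast
  show ?thesis
    by (rule groupI)
       (use S.m_assoc S.r_inv_ex S.m_closed S.one_closed S.l_one S.r_one in
         \<open>auto simp: transducer_group_def Let_def\<close>)
qed

lemma inv_transducer_group:
  assumes gens: "state_action T ` states T \<subseteq> carrier (BijGroup (lists (alphabet T)))"
    and f: "f \<in> carrier (transducer_group T)"
  shows "inv\<^bsub>transducer_group T\<^esub> f = inv\<^bsub>BijGroup (lists (alphabet T))\<^esub> f"
proof (rule group.inv_equality[OF group_transducer_group[OF gens] _ f])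
  let ?B = "BijGroup (lists (alphabet T))"
  interpret B: group ?B by (rule group_BijGroup)
  have g: "f \<in> generate ?B (state_action T ` states T)"
    using f by (simp add: transducer_group_def Let_def)
  then have "f \<in> carrier ?B"
    using B.generate_in_carrier[OF gens] by blast
  then show "inv\<^bsub>?B\<^esub> f \<otimes>\<^bsub>transducer_group T\<^esub> f = \<one>\<^bsub>transducer_group T\<^esub>"
    by (simp add: transducer_group_def Let_def)
  show "inv\<^bsub>?B\<^esub> f \<in> carrier (transducer_group T)"
    using B.generate_m_inv_closed[OF gens g] by (simp add: transducer_group_def Let_def)
qed

lemma state_action_in_transducer_group:
  "q \<in> states T \<Longrightarrow> state_action T q \<in> carrier (transducer_group T)"
  by (auto simp: transducer_group_def Let_def intro: generate.incl)

text \<open>The image is a subgroup that contains the generators. The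
  carrier is generated with respect to the opposite multiplication, which gives the same elements,
  since a subgroup is closed under products in either order.\<close>

lemma free_lift_transducer_group_surj:
  assumes gens: "state_action T ` states T \<subseteq> carrier (BijGroup (lists (alphabet T)))"
  shows "free_lift (transducer_group T) (state_action T) ` carrier (free_group (states T)) =
    carrier (transducer_group T)"
proof -
  let ?B = "BijGroup (lists (alphabet T))"
  let ?F = "free_group (states T)" and ?K = "transducer_group T"
  let ?\<psi> = "free_lift ?K (state_action T)"
  interpret F: group ?F by (rule group_free_group)
  interpret K: group ?K by (rule group_transducer_group[OF gens])
  have acts: "state_action T \<in> states T \<rightarrow> carrier ?K"
    by (simp add: state_action_in_transducer_group)
  interpret \<psi>: group_hom ?F ?K ?\<psi>
    by unfold_locales (rule K.free_lift_hom[OF acts])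
  interpret I: subgroup "?\<psi> ` carrier ?F" ?K
    by (rule \<psi>.img_is_subgroup)
  have gen: "state_action T q \<in> ?\<psi> ` carrier ?F" if "q \<in> states T" for q
    using that K.free_lift_gen[OF acts that] by (metis free_gen_in image_eqI)
  have "k \<in> ?\<psi> ` carrier ?F" if "k \<in> generate ?B (state_action T ` states T)" for k
    using that
  proof induction
    case one
    then show ?case using I.one_closed by (simp add: transducer_group_def Let_def)
  next
    case (incl h)
    then show ?case using gen by blast
  next
    case (inv h)
    then show ?case
      using I.m_inv_closed gen inv_transducer_group[OF gens] acts
      by (metis (no_types, lifting) image_iff PiE)
  next
    case (eng h1 h2)
    then show ?case
      using I.m_closed[of h2 h1] by (simp add: transducer_group_def Let_def)
  qed
  then show ?thesis
    using \<psi>.hom_closed by (auto simp: transducer_group_def Let_def)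
qed

section \<open>The dual of the palindrome Cayley machine\<close>

context group
begin

lemma state_action_dual_palindrome_cayley_machine:
  assumes "x \<in> carrier G"
  shows "state_action (dual (palindrome_cayley_machine G)) x = alt_translation G x (inv x)"
proof -
  have "run (dual (palindrome_cayley_machine G)) x w = alt_mult G x (inv x) w"
    if "w \<in> lists (carrier G)" for w
    using that assms
    by (induction w arbitrary: x) (auto simp: dual_def palindrome_cayley_machine_def)
  then show ?thesis
    by (auto simp: state_action_def alt_translation_def dual_def palindrome_cayley_machine_def
             simp del: in_lists_conv_set)
qed

lemma state_action_dual_palindrome_in_BijGroup:
  fixes T defines "T \<equiv> dual (palindrome_cayley_machine G)"
  shows "state_action T ` states T \<subseteq> carrier (BijGroup (lists (alphabet T)))"
  by (auto simp: T_def dual_def palindrome_cayley_machine_def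
      alt_translation_in_BijGroup
      state_action_dual_palindrome_cayley_machine[unfolded dual_def palindrome_cayley_machine_def, simplified])

text \<open>The pairs \<open>(x, x\<inverse>)\<close> determine a homomorphism from the free group to \<open>G \<times> G\<close>, and
  \<open>G \<times> G\<close> acts by alternating translations. The action is on the right, which is why it agrees
  with the convention that left factors are applied first.\<close>

lemma free_lift_transducer_group:
  fixes T defines "T \<equiv> dual (palindrome_cayley_machine G)"
  assumes "w \<in> lists (carrier G <+> carrier G)"
  shows "free_lift (transducer_group T) (state_action T) w =
    alt_translation G (free_lift G (\<lambda>x. x) w) (free_lift G (\<lambda>x. inv x) w)"
  using assms(2)
proof (induction w rule: list.induct)
  let ?B = "BijGroup (lists (carrier G))" and ?K = "transducer_group T"
  have T: "states T = carrier G" "alphabet T = carrier G"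
    by (simp_all add: T_def dual_def palindrome_cayley_machine_def)
  have K: "mult ?K = (\<lambda>f g. g \<otimes>\<^bsub>?B\<^esub> f)" "\<one>\<^bsub>?K\<^esub> = \<one>\<^bsub>?B\<^esub>"
    by (simp_all add: transducer_group_def Let_def T)
  {
    case Nil
    then show ?case
      by (simp add: free_lift_def K alt_translation_one)
  next
    case (Cons c w)
    have id: "(\<lambda>x. x) \<in> carrier G \<rightarrow> carrier G" and i: "(\<lambda>x. inv x) \<in> carrier G \<rightarrow> carrier G"
      by auto
    have c: "c \<in> carrier G <+> carrier G" and w: "w \<in> lists (carrier G <+> carrier G)"
      using Cons.prems by auto
    have st: "state_action T x = alt_translation G x (inv x)" if "x \<in> carrier G" for x
      using that state_action_dual_palindrome_cayley_machine by (simp add: T_def)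
    have inv_st: "inv\<^bsub>?K\<^esub> state_action T x = alt_translation G (inv x) (inv (inv x))"
      if x: "x \<in> carrier G" for x
    proof -
      have "inv\<^bsub>?K\<^esub> state_action T x = inv\<^bsub>?B\<^esub> state_action T x"
        using inv_transducer_group state_action_dual_palindrome_in_BijGroup
          state_action_in_transducer_group x T unfolding T_def by metis
      then show ?thesis using st[OF x] inv_alt_translation x by simp
    qed
    have "letter_value ?K (state_action T) c =
        alt_translation G (letter_value G (\<lambda>x. x) c) (letter_value G (\<lambda>x. inv x) c)"
      using c st inv_st by (cases c) auto
    moreover have "free_lift ?K (state_action T) (c # w) =
        free_lift ?K (state_action T) w \<otimes>\<^bsub>?B\<^esub> letter_value ?K (state_action T) c"
      by (simp add: free_lift_def K)
    ultimately show ?case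
      using Cons.IH[OF w] free_lift_closed[OF id w] free_lift_closed[OF i w]
        letter_value_closed[OF id c] letter_value_closed[OF i c]
      by (simp add: alt_translation_mult free_lift_Cons)
  }
qed

end

section \<open>The transducer group and its stabilizers\<close>

theorem proposition13:
  fixes G :: "('g, 'm) monoid_scheme"
  assumes "group G" and "finite (carrier G)"
  defines "F \<equiv> free_group (carrier G)"
    and "H \<equiv> canonical_kernel G"
    and "T \<equiv> dual (palindrome_cayley_machine G)"
  defines "K \<equiv> transducer_group T"
  shows "\<exists>\<phi> \<in> iso (F Mod (H \<inter> mirror H)) K.
    (\<forall>x\<in>carrier G. \<phi> ((H \<inter> mirror H) #>\<^bsub>F\<^esub> free_gen x) = state_action T x) \<and>
    (\<forall>u\<in>lists (carrier G). length u = 1 \<longrightarrow>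
      stabilizer K (\<lambda>k. k) u = \<phi> ` carrier (F\<lparr>carrier := H\<rparr> Mod (H \<inter> mirror H))) \<and>
    (\<forall>u\<in>lists (carrier G). length u \<ge> 2 \<longrightarrow> stabilizer K (\<lambda>k. k) u = {\<one>\<^bsub>K\<^esub>})"
proof -
  interpret G: group G by (rule assms(1))
  define N where "N = H \<inter> mirror H"
  define a where "a = free_lift G (\<lambda>x. x)"
  define b where "b = free_lift G (\<lambda>x. inv\<^bsub>G\<^esub> x)"
  define \<psi> where "\<psi> = free_lift K (state_action T)"
  have T: "states T = carrier G" "alphabet T = carrier G"
    by (simp_all add: T_def dual_def palindrome_cayley_machine_def)
  have gens: "state_action T ` states T \<subseteq> carrier (BijGroup (lists (alphabet T)))"
    unfolding T_def by (rule G.state_action_dual_palindrome_in_BijGroup)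
  interpret F: group F unfolding F_def by (rule group_free_group)
  interpret K: group K unfolding K_def by (rule group_transducer_group[OF gens])
  have acts: "state_action T \<in> carrier G \<rightarrow> carrier K"
    using state_action_in_transducer_group[of _ T] by (simp add: T K_def)
  interpret \<psi>: group_hom F K \<psi>
    by unfold_locales (simp add: F_def \<psi>_def K.free_lift_hom[OF acts])
  have surj: "\<psi> ` carrier F = carrier K"
    using free_lift_transducer_group_surj[OF gens] by (simp add: \<psi>_def F_def K_def T)
  have \<psi>: "\<psi> w = alt_translation G (a w) (b w)" and ab: "a w \<in> carrier G" "b w \<in> carrier G"
    if "w \<in> carrier F" for w
    using that G.free_lift_transducer_group[of w] G.free_lift_closed[of "\<lambda>x. x" "carrier G" w]
      G.free_lift_closed[of "\<lambda>x. inv\<^bsub>G\<^esub> x" "carrier G" w]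
    by (simp_all add: \<psi>_def K_def T_def a_def b_def F_def free_group_def del: in_lists_conv_set)
  have H: "H = {w \<in> carrier F. a w = \<one>\<^bsub>G\<^esub>}"
    by (simp add: H_def F_def a_def canonical_kernel_def kernel_def)
  have N: "N = {w \<in> carrier F. a w = \<one>\<^bsub>G\<^esub> \<and> b w = \<one>\<^bsub>G\<^esub>}"
    using G.mirror_canonical_kernel H by (auto simp: N_def H_def F_def b_def kernel_def)
  have oneK: "\<one>\<^bsub>K\<^esub> = alt_translation G \<one>\<^bsub>G\<^esub> \<one>\<^bsub>G\<^esub>"
    using G.alt_translation_one by (simp add: K_def transducer_group_def Let_def T)
  have fix_long: "\<psi> w u = u \<longleftrightarrow> w \<in> N"
    if "w \<in> carrier F" "u \<in> lists (carrier G)" "length u \<ge> 2" for w u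
    using that \<psi> ab G.alt_translation_fixes_iff[of "a w" "b w" u] by (simp add: N)
  have fix_short: "\<psi> w u = u \<longleftrightarrow> w \<in> H"
    if "w \<in> carrier F" "u \<in> lists (carrier G)" "length u = 1" for w u
    using that \<psi> ab G.alt_translation_fixes_singleton_iff[of "a w" "hd u" "b w"]
    by (auto simp: H length_Suc_conv)
  have ker: "kernel F K \<psi> = N"
  proof -
    \<comment> \<open>Any word of length two detects the identity.\<close>
    have "\<psi> w = \<one>\<^bsub>K\<^esub> \<longleftrightarrow> w \<in> N" if w: "w \<in> carrier F" for w
    proof
      assume "\<psi> w = \<one>\<^bsub>K\<^esub>"
      then have "\<psi> w [\<one>\<^bsub>G\<^esub>, \<one>\<^bsub>G\<^esub>] = [\<one>\<^bsub>G\<^esub>, \<one>\<^bsub>G\<^esub>]"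
        by (simp add: oneK alt_translation_def)
      then show "w \<in> N" using fix_long[OF w] by simp
    qed (use \<psi>[OF w] oneK N in simp)
    then show ?thesis by (auto simp: kernel_def N)
  qed
  define \<phi> where "\<phi> = (\<lambda>X. the_elem (\<psi> ` X))"
  have iso: "\<phi> \<in> iso (F Mod N) K"
    using \<psi>.FactGroup_iso_set[OF surj] by (simp add: \<phi>_def ker)
  have \<phi>: "\<phi> (N #>\<^bsub>F\<^esub> w) = \<psi> w" if w: "w \<in> carrier F" for w
  proof -
    have "\<psi> v = \<psi> w" if "v \<in> N #>\<^bsub>F\<^esub> w" for v
      using that w by (auto simp: r_coset_def kernel_def simp flip: ker)
    moreover have "w \<in> N #>\<^bsub>F\<^esub> w"
      using F.rcos_self[OF w] \<psi>.subgroup_kernel ker by simp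
    ultimately have "\<psi> ` (N #>\<^bsub>F\<^esub> w) = {\<psi> w}" by blast
    then show ?thesis by (simp add: \<phi>_def)
  qed
  have "\<phi> (N #>\<^bsub>F\<^esub> free_gen x) = state_action T x" if "x \<in> carrier G" for x
    using that \<phi>[of "free_gen x"] K.free_lift_gen[OF acts that] by (simp add: F_def \<psi>_def)
  moreover have "stabilizer K (\<lambda>k. k) u = \<phi> ` carrier (F\<lparr>carrier := H\<rparr> Mod N)"
    if "u \<in> lists (carrier G)" "length u = 1" for u
  proof -
    have "carrier (F\<lparr>carrier := H\<rparr> Mod N) = (\<lambda>w. N #>\<^bsub>F\<^esub> w) ` H"
      by (simp add: carrier_FactGroup r_coset_def)
    then have "\<phi> ` carrier (F\<lparr>carrier := H\<rparr> Mod N) = \<psi> ` H"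
      using \<phi> H by (auto simp: image_image)
    also have "\<dots> = stabilizer K (\<lambda>k. k) u"
      using fix_short[OF _ that] H by (auto simp: stabilizer_def simp flip: surj)
    finally show ?thesis by simp
  qed
  moreover have "stabilizer K (\<lambda>k. k) u = {\<one>\<^bsub>K\<^esub>}"
    if "u \<in> lists (carrier G)" "length u \<ge> 2" for u
  proof -
    have "stabilizer K (\<lambda>k. k) u = \<psi> ` kernel F K \<psi>"
      using fix_long[OF _ that] N by (auto simp: stabilizer_def ker simp flip: surj)
    also have "\<dots> = {\<one>\<^bsub>K\<^esub>}"
      using \<psi>.hom_one by (auto simp: kernel_def image_iff)
    finally show ?thesis .
  qed
  ultimately show ?thesis
    using iso unfolding N_def by blast
qed

end
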